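(* Let $X$ be an infinite countably compact zero-dimensional $T_1$-space. If every compact subset of $X$ is finite, then $X$ is not sequentially $2$-Ascoli.
   Context: Zero-dimensional means having a base of clopen sets. $X$ is countably compact if every sequence in $X$ has a cluster point. For the discrete two-point space $\mathbf{2}=\{0,1\}$, $C_k(X,\mathbf{2})$ is the space of continuous functions $X\to\mathbf{2}$ with the compact-open topology. $X$ is sequentially $2$-Ascoli if every convergent sequence $S\subseteq C_k(X,\mathbf{2})$ (with its limit included) is evenly continuous, i.e. the evaluation map $S\times X\to\mathbf{2}$, $(f,x)\mapsto f(x)$, is continuous. *)

theory Defs
  imports "HOL-Analysis.Analysis"
begin

definition zero_dimensional_space :: "'a topology \<Rightarrow> bool" where
  "zero_dimensional_space X \<longleftrightarrow>
     (\<exists>\<B>. (\<forall>U\<in>\<B>. openin X U \<and> closedin X U) \<and> openin X = arbitrary union_of (\<lambda>U. U \<in> \<B>))"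

definition cluster_point_in :: "'a topology \<Rightarrow> (nat \<Rightarrow> 'a) \<Rightarrow> 'a \<Rightarrow> bool" where
  "cluster_point_in X \<sigma> x \<longleftrightarrow>
     x \<in> topspace X \<and> (\<forall>U. openin X U \<and> x \<in> U \<longrightarrow> (\<exists>\<^sub>F n in sequentially. \<sigma> n \<in> U))"

definition countably_compact_space :: "'a topology \<Rightarrow> bool" where
  "countably_compact_space X \<longleftrightarrow>
     (\<forall>\<sigma>. range \<sigma> \<subseteq> topspace X \<longrightarrow> (\<exists>x. cluster_point_in X \<sigma> x))"

text \<open>A continuous function is represented by its unique representative that is
  \<^const>\<open>undefined\<close> off the carrier of its domain.\<close>

definition continuous_functions :: "'a topology \<Rightarrow> 'b topology \<Rightarrow> ('a \<Rightarrow> 'b) set" where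
  "continuous_functions X Y = {f \<in> extensional (topspace X). continuous_map X Y f}"

definition compact_open_topology :: "'a topology \<Rightarrow> 'b topology \<Rightarrow> ('a \<Rightarrow> 'b) topology" where
  "compact_open_topology X Y =
     topology_generated_by
       {{f \<in> continuous_functions X Y. f ` K \<subseteq> U} |K U. compactin X K \<and> openin Y U}"

lemma topspace_compact_open_topology [simp]:
  "topspace (compact_open_topology X Y) = continuous_functions X Y"
proof -
  have "continuous_functions X Y = {f \<in> continuous_functions X Y. f ` {} \<subseteq> {}}"
    by simp
  then have "continuous_functions X Y \<in>
      {{f \<in> continuous_functions X Y. f ` K \<subseteq> U} |K U. compactin X K \<and> openin Y U}"
    using compactin_empty openin_empty by blast
  then show ?thesis
    unfolding compact_open_topology_def topology_generated_by_topspace by blast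
qed

definition two_point_space :: "nat topology" where
  "two_point_space = discrete_topology {0, 1}"

definition evenly_continuous_on ::
    "'a topology \<Rightarrow> 'b topology \<Rightarrow> ('a \<Rightarrow> 'b) set \<Rightarrow> bool" where
  "evenly_continuous_on X Y S \<longleftrightarrow>
     continuous_map (prod_topology (subtopology (compact_open_topology X Y) S) X) Y
       (\<lambda>(f, x). f x)"

definition sequentially_2_Ascoli :: "'a topology \<Rightarrow> bool" where
  "sequentially_2_Ascoli X \<longleftrightarrow>
     (\<forall>\<phi> g. range \<phi> \<subseteq> continuous_functions X two_point_space \<and>
            limitin (compact_open_topology X two_point_space) \<phi> g sequentially \<longrightarrow>
            evenly_continuous_on X two_point_space (insert g (range \<phi>)))"

end

theory Submission
  imports Defs
begin

text \<open>Repeatedly splitting off clopen pieces yields pairwise disjoint nonempty clopen sets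
  \<open>U n\<close>. Their indicator functions converge pointwise to \<open>0\<close>, hence in the compact-open
  topology, as compact sets are finite. If \<open>x\<close> is a cluster point of points \<open>p n \<in> U n\<close>, then
  evaluation is discontinuous at \<open>(0, x)\<close>, since the indicator of \<open>U n\<close> is \<open>1\<close> at \<open>p n\<close>.\<close>

lemma zero_dimensional_spaceE:
  assumes "zero_dimensional_space X" "openin X V" "x \<in> V"
  obtains U where "openin X U" "closedin X U" "x \<in> U" "U \<subseteq> V"
proof -
  obtain \<B> where \<B>: "\<forall>U\<in>\<B>. openin X U \<and> closedin X U"
    and eq: "openin X = arbitrary union_of (\<lambda>U. U \<in> \<B>)"
    using assms(1) unfolding zero_dimensional_space_def by blast
  obtain \<U> where "\<U> \<subseteq> \<B>" "\<Union>\<U> = V"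
    using assms(2) unfolding eq union_of_def arbitrary_def by auto
  then show thesis
    using that \<B> assms(3) by (meson Union_iff Union_upper subsetD)
qed

text \<open>Convergence can be tested on a subbasis: the sets that, if they contain
  \<open>l\<close>, eventually contain \<open>f n\<close> are closed under binary intersections and
  arbitrary unions, so induction over the generation of the topology applies.\<close>

lemma limitin_topology_generated_by:
  assumes "l \<in> \<Union>\<S>"
    and "\<And>U. U \<in> \<S> \<Longrightarrow> l \<in> U \<Longrightarrow> \<forall>\<^sub>F n in F. f n \<in> U"
  shows "limitin (topology_generated_by \<S>) f l F"
proof -
  have "l \<in> U \<longrightarrow> (\<forall>\<^sub>F n in F. f n \<in> U)" if "generate_topology_on \<S> U" for U
    using that
  proof induction
    case (Int a b)
    then show ?case by (auto simp: eventually_conj_iff)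
  next
    case (UN K)
    show ?case
    proof
      assume "l \<in> \<Union>K"
      then obtain k where "k \<in> K" "l \<in> k" by blast
      with UN.IH have "\<forall>\<^sub>F n in F. f n \<in> k" by blast
      then show "\<forall>\<^sub>F n in F. f n \<in> \<Union>K"
        by (rule eventually_mono) (use \<open>k \<in> K\<close> in blast)
    qed
  qed (use assms in auto)
  then show ?thesis
    using assms(1) by (simp add: limitin_def openin_topology_generated_by_iff)
qed

text \<open>Two points of \<open>C\<close> are separated by a clopen \<open>V\<close>, which splits
  \<open>C\<close> into two proper clopen pieces, \<open>V\<close> and \<open>C - V\<close>. At
  least one of them is infinite.\<close>

lemma infinite_clopen_split:
  assumes "zero_dimensional_space X" "t1_space X"
    and "openin X C" "closedin X C" "infinite C"
  obtains D where "openin X D" "closedin X D" "infinite D" "D \<subset> C"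
proof -
  obtain x y where xy: "x \<in> C" "y \<in> C" "x \<noteq> y"
    using assms(5) by (metis finite.simps finite_subset insertI1 subsetI singletonD)
  have "openin X (C - {y})"
    using assms(2,3) xy closedin_subset[OF assms(4)]
    by (auto simp: closedin_t1_singleton intro!: openin_diff)
  then obtain V where V: "openin X V" "closedin X V" "x \<in> V" "V \<subseteq> C - {y}"
    using assms(1) xy zero_dimensional_spaceE[of X "C - {y}" x] by blast
  show thesis
  proof (cases "finite V")
    case True
    then show thesis
      \<comment> \<open>Here \<open>C - V\<close> is a proper subset because it misses
        \<open>x\<close>; in the other case \<open>V\<close> is one because it misses
        \<open>y\<close>.\<close>
      using that[of "C - V"] assms V xy by (auto intro: openin_diff closedin_diff)
  next
    case False
    then show thesis
      using that[of V] V xy by blast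
  qed
qed

text \<open>Splitting repeatedly gives a strictly decreasing chain of clopen sets
  \<open>C n\<close>, and the differences \<open>C n - C (Suc n)\<close> are as required. Keeping
  every \<open>C n\<close> infinite is what lets the recursion continue.\<close>

lemma infinite_disjoint_clopen_sequence:
  assumes "zero_dimensional_space X" "t1_space X" "infinite (topspace X)"
  obtains U :: "nat \<Rightarrow> 'a set"
  where "\<And>n. openin X (U n)" "\<And>n. closedin X (U n)" "\<And>n. U n \<noteq> {}" "disjoint_family U"
proof -
  let ?P = "\<lambda>C. openin X C \<and> closedin X C \<and> infinite C"
  have "\<exists>C. \<forall>n::nat. ?P (C n) \<and> C (Suc n) \<subset> C n"
  proof (rule dependent_nat_choice)
    show "\<exists>C. ?P C" using assms(3) by (intro exI[of _ "topspace X"]) simp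
    show "\<exists>D. ?P D \<and> D \<subset> C" if "?P C" for C
      using infinite_clopen_split[OF assms(1,2)] that by metis
  qed
  then obtain C where C: "\<And>n::nat. ?P (C n)" "\<And>n. C (Suc n) \<subset> C n" by blast
  have anti: "C n \<subseteq> C m" if "m \<le> n" for m n
    using that C(2) lift_Suc_antimono_le[of C] by blast
  have "(C m - C (Suc m)) \<inter> (C n - C (Suc n)) = {}" if "m < n" for m n
    using anti[of "Suc m" n] that by auto
  then have "disjoint_family (\<lambda>n. C n - C (Suc n))"
    unfolding disjoint_family_on_def by (metis Int_commute linorder_neqE_nat)
  then show thesis
    using that[of "\<lambda>n. C n - C (Suc n)"] C by (auto intro!: openin_diff closedin_diff)
qed

lemma limitin_compact_open_topology_finite:
  assumes "\<And>K. compactin X K \<Longrightarrow> finite K"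
    and "range \<phi> \<subseteq> continuous_functions X Y" "g \<in> continuous_functions X Y"
    and "\<And>x. x \<in> topspace X \<Longrightarrow> limitin Y (\<lambda>n. \<phi> n x) (g x) sequentially"
  shows "limitin (compact_open_topology X Y) \<phi> g sequentially"
  unfolding compact_open_topology_def
proof (rule limitin_topology_generated_by)
  let ?S = "{{f \<in> continuous_functions X Y. f ` K \<subseteq> U} |K U. compactin X K \<and> openin Y U}"
  \<comment> \<open>The union of the subbasis is the carrier of the generated topology, already
    identified as \<open>continuous_functions X Y\<close>.\<close>
  show "g \<in> \<Union>?S"
    using assms(3) topspace_compact_open_topology[of X Y]
    unfolding compact_open_topology_def topology_generated_by_topspace by simp
  fix W assume "W \<in> ?S" "g \<in> W"
  then obtain K U where W: "W = {f \<in> continuous_functions X Y. f ` K \<subseteq> U}"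
    "compactin X K" "openin Y U" "g ` K \<subseteq> U" by auto
  have "\<forall>\<^sub>F n in sequentially. \<phi> n x \<in> U" if "x \<in> K" for x
    using assms(4)[of x] that W compactin_subset_topspace[OF W(2)] by (auto simp: limitin_def)
  then have "\<forall>\<^sub>F n in sequentially. \<forall>x\<in>K. \<phi> n x \<in> U"
    using assms(1)[OF W(2)] by (simp add: eventually_ball_finite)
  then show "\<forall>\<^sub>F n in sequentially. \<phi> n \<in> W"
    by (rule eventually_mono) (use assms(2) W(1) in auto)
qed

text \<open>Continuity of evaluation at \<open>(g, x)\<close> gives a box
  \<open>A \<times> B\<close> that is mapped into \<open>V\<close>. Eventually
  \<open>\<phi> n\<close> lies in \<open>A\<close> and frequently \<open>p n\<close> lies in
  \<open>B\<close>, so frequently both hold.\<close>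

lemma evenly_continuous_on_limitin_cluster_point:
  assumes "evenly_continuous_on X Y (insert g (range \<phi>))"
    and lim: "limitin (compact_open_topology X Y) \<phi> g sequentially"
    and clust: "cluster_point_in X p x"
    and "openin Y V" "g x \<in> V"
  shows "\<exists>\<^sub>F n in sequentially. \<phi> n (p n) \<in> V"
proof -
  let ?T = "subtopology (compact_open_topology X Y) (insert g (range \<phi>))"
  let ?E = "{z \<in> topspace (prod_topology ?T X). (\<lambda>(f, x). f x) z \<in> V}"
  have "openin (prod_topology ?T X) ?E"
    using assms(1,4) unfolding evenly_continuous_on_def
    by (rule openin_continuous_map_preimage)
  moreover have "(g, x) \<in> ?E"
    using assms(5) lim clust
    by (auto simp: limitin_def cluster_point_in_def topspace_subtopology)
  ultimately obtain A B where AB: "openin ?T A" "openin X B" "g \<in> A" "x \<in> B" "A \<times> B \<subseteq> ?E"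
    unfolding openin_prod_topology_alt by meson
  \<comment> \<open>Convergence passes to the subspace since it contains the limit and all
    terms.\<close>
  have "limitin ?T \<phi> g sequentially"
    using lim by (auto simp: limitin_subtopology)
  then have "\<forall>\<^sub>F n in sequentially. \<phi> n \<in> A"
    using AB by (auto simp: limitin_def)
  moreover have "\<exists>\<^sub>F n in sequentially. p n \<in> B"
    using clust AB by (auto simp: cluster_point_in_def)
  ultimately have "\<exists>\<^sub>F n in sequentially. p n \<in> B \<and> \<phi> n \<in> A"
    using frequently_eventually_frequently by blast
  then show ?thesis
    by (rule frequently_elim1) (use AB(5) in auto)
qed

text \<open>Every preimage under the indicator is a union of some of the two open sets
  \<open>U\<close> and \<open>topspace X - U\<close>. Restricting yields the representative that is
  \<open>undefined\<close> off the carrier.\<close>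

lemma restrict_indicator_in_continuous_functions:
  assumes "openin X U" "closedin X U"
  shows "restrict (indicator U) (topspace X) \<in> continuous_functions X two_point_space"
proof -
  have "openin X {x \<in> topspace X. indicator U x \<in> T}" for T :: "nat set"
  proof -
    have "{x \<in> topspace X. indicator U x \<in> T} =
        (if 1 \<in> T then U else {}) \<union> (if 0 \<in> T then topspace X - U else {})"
      using openin_subset[OF assms(1)] by (auto simp: indicator_def split: if_splits)
    then show ?thesis
      using assms by (auto intro!: openin_Un)
  qed
  then have "continuous_map X two_point_space (indicator U)"
    by (auto simp: continuous_map_def two_point_space_def indicator_def)
  then have "continuous_map X two_point_space (restrict (indicator U) (topspace X))"
    by (rule continuous_map_eq) simp
  then show ?thesis
    by (simp add: continuous_functions_def)
qed

theorem proposition3p3: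
  fixes X :: "'a topology"
  assumes "infinite (topspace X)"
    and "countably_compact_space X"
    and "zero_dimensional_space X"
    and "t1_space X"
    and "\<And>K. compactin X K \<Longrightarrow> finite K"
  shows "\<not> sequentially_2_Ascoli X"
proof
  assume Ascoli: "sequentially_2_Ascoli X"
  obtain U where U: "\<And>n. openin X (U n)" "\<And>n. closedin X (U n)" "\<And>n. U n \<noteq> {}"
    "disjoint_family (U :: nat \<Rightarrow> 'a set)"
    using infinite_disjoint_clopen_sequence[OF assms(3,4,1)] by blast
  define \<phi> :: "nat \<Rightarrow> 'a \<Rightarrow> nat" where "\<phi> n = restrict (indicator (U n)) (topspace X)" for n
  \<comment> \<open>The zero function is written as the indicator of the clopen set
    \<open>{}\<close>, so that its continuity follows from the same lemma as that of
    \<open>\<phi> n\<close>.\<close>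
  define g :: "'a \<Rightarrow> nat" where "g = restrict (indicator {}) (topspace X)"
  have \<phi>: "range \<phi> \<subseteq> continuous_functions X two_point_space"
    using restrict_indicator_in_continuous_functions[OF U(1,2)] by (auto simp: \<phi>_def)
  have g: "g \<in> continuous_functions X two_point_space"
    unfolding g_def by (intro restrict_indicator_in_continuous_functions) auto
  have "\<forall>\<^sub>F n in sequentially. \<phi> n x = g x" if "x \<in> topspace X" for x
  proof (cases "\<exists>m. x \<in> U m")
    case True
    then obtain m where "x \<in> U m" by blast
    \<comment> \<open>By disjointness \<open>x\<close> lies in no other member of the family, so
      \<open>\<phi> n x = 0\<close> from \<open>m + 1\<close> on.\<close>
    then have "x \<notin> U n" if "n > m" for n
      using U(4) that unfolding disjoint_family_on_def by (metis IntI UNIV_I empty_iff less_irrefl)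
    then show ?thesis
      using that by (intro eventually_mono[OF eventually_gt_at_top[of m]]) (auto simp: \<phi>_def g_def)
  qed (use that in \<open>auto simp: \<phi>_def g_def\<close>)
  then have "limitin two_point_space (\<lambda>n. \<phi> n x) (g x) sequentially" if "x \<in> topspace X" for x
    using that by (intro limitin_eventually) (auto simp: two_point_space_def g_def)
  then have lim: "limitin (compact_open_topology X two_point_space) \<phi> g sequentially"
    using assms(5) \<phi> g by (intro limitin_compact_open_topology_finite)
  have "\<forall>n. \<exists>y. y \<in> U n" using U(3) by blast
  then obtain p where p: "\<And>n. p n \<in> U n" by metis
  have pX: "p n \<in> topspace X" for n
    using p U(1) openin_subset by blast
  then obtain x where x: "cluster_point_in X p x"
    using assms(2) unfolding countably_compact_space_def by blast
  have "\<exists>\<^sub>F n in sequentially. \<phi> n (p n) \<in> {0}"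
  proof (rule evenly_continuous_on_limitin_cluster_point[OF _ lim x])
    show "evenly_continuous_on X two_point_space (insert g (range \<phi>))"
      using Ascoli \<phi> lim unfolding sequentially_2_Ascoli_def by blast
    show "openin two_point_space {0}" by (simp add: two_point_space_def)
    show "g x \<in> {0}" using x by (simp add: g_def cluster_point_in_def)
  qed
  \<comment> \<open>Since \<open>p n \<in> U n\<close>, the value \<open>\<phi> n (p n)\<close> is
    \<open>1\<close> for every \<open>n\<close>, so it cannot be \<open>0\<close>
    frequently.\<close>
  then show False
    using p pX by (simp add: \<phi>_def)
qed

end
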